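(* Let $f\in\mathcal F_{<\infty}(\mathbb R^n)$, $r>0$, $x_0\in\mathbb R^n$, and let $(x,z)$ be the $C^1(\mathbb R_{\ge0})$ solution of the NAG ODE $$\dot x(t)=\frac rt\,(z(t)-x(t)),\qquad \dot z(t)=-\frac tr\,\nabla f(x(t))\qquad(t>0),\qquad x(0)=z(0)=x_0.$$ Define $p(t):=\frac{r(r+2)}{t^2}(x(t)-z(t))=-\frac{r+2}{t}\dot x(t)$ for $t>0$. (a) $p(t)\in\operatorname{dom} f^*$ for all $t>0$. (b) Suppose moreover that $\operatorname{dom} f^*$ has a minimum-norm point $p^\star$. Then for all $t>0$, $$\|p(t)-p^\star\|^2\le\|p(t)\|^2-\|p^\star\|^2\le\frac{2(r+2)^2D_f(x_0,p^\star)}{t^2}.$$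
   Context: $\|\cdot\|$ and $\langle\cdot,\cdot\rangle$ are the Euclidean norm and inner product on $\mathbb R^n$. $\mathcal F_{<\infty}(\mathbb R^n):=\bigcup_{L>0}\mathcal F_L(\mathbb R^n)$, where $\mathcal F_L(\mathbb R^n)$ is the set of finite-valued differentiable convex functions $f:\mathbb R^n\to\mathbb R$ whose gradient is $L$-Lipschitz. The Legendre--Fenchel conjugate is $f^*(p):=\sup_{x\in\mathbb R^n}\{\langle p,x\rangle-f(x)\}\in\mathbb R\cup\{\infty\}$, and $\operatorname{dom} f^*:=\{p\in\mathbb R^n: f^*(p)<\infty\}$ (convex, nonempty, not necessarily closed). The dual divergence is $D_f(x,p):=f(x)+f^*(p)-\langle p,x\rangle$. The NAG ODE is known to have a unique solution in $C^1(\mathbb R_{\ge0})$, $\mathbb R_{\ge0}=[0,\infty)$. *)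

theory Defs
  imports "HOL-Analysis.Analysis"
begin

definition grad :: "('a::real_inner \<Rightarrow> real) \<Rightarrow> 'a \<Rightarrow> 'a" where
  "grad f x = (THE D. GDERIV f x :> D)"

lemma grad_eqI:
  assumes "GDERIV f x :> D"
  shows "grad f x = D"
  unfolding grad_def
proof (rule the_equality)
  fix E assume "GDERIV f x :> E"
  then have "(\<lambda>h. h \<bullet> E) = (\<lambda>h. h \<bullet> D)"
    using assms unfolding gderiv_def by (rule has_derivative_unique)
  then show "E = D"
    by (metis vector_eq_ldot)
qed (rule assms)

lemma GDERIV_grad:
  fixes f :: "'a::euclidean_space \<Rightarrow> real"
  assumes "f differentiable (at x)"
  shows "GDERIV f x :> grad f x"
proof -
  obtain f' where f': "(f has_derivative f') (at x)"
    using assms unfolding differentiable_def by blast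
  then have "linear f'"
    by (rule has_derivative_linear)
  then have "f' = (\<lambda>h. h \<bullet> adjoint f' 1)"
    using adjoint_works[of f'] by (metis inner_real_def mult_1_right)
  with f' have "GDERIV f x :> adjoint f' 1"
    unfolding gderiv_def by simp
  then show ?thesis
    using grad_eqI by metis
qed

definition smooth_convex :: "real \<Rightarrow> ('a::real_inner \<Rightarrow> real) set" where
  "smooth_convex L =
     {f. convex_on UNIV f \<and> (\<forall>x. f differentiable (at x)) \<and> L-lipschitz_on UNIV (grad f)}"

definition smooth_convex_fin :: "('a::real_inner \<Rightarrow> real) set" where
  "smooth_convex_fin = (\<Union>L\<in>{0<..}. smooth_convex L)"

definition conjugate :: "('a::real_inner \<Rightarrow> real) \<Rightarrow> 'a \<Rightarrow> ereal" where
  "conjugate f p = (SUP x. ereal (p \<bullet> x - f x))"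

definition conj_dom :: "('a::real_inner \<Rightarrow> real) \<Rightarrow> 'a set" where
  "conj_dom f = {p. conjugate f p < \<infinity>}"

definition dual_div :: "('a::real_inner \<Rightarrow> real) \<Rightarrow> 'a \<Rightarrow> 'a \<Rightarrow> ereal" where
  "dual_div f x p = ereal (f x) + conjugate f p - ereal (p \<bullet> x)"

definition min_norm_point :: "'a::real_normed_vector set \<Rightarrow> 'a \<Rightarrow> bool" where
  "min_norm_point S p \<longleftrightarrow> p \<in> S \<and> (\<forall>q\<in>S. norm p \<le> norm q)"

text \<open>The library's \<^const>\<open>C1_differentiable_on\<close> asks for a two-sided derivative at
  every point of the set; at the left endpoint 0 the derivative is one-sided here, so that
  values at negative times play no role.\<close>
definition C1_nonneg :: "(real \<Rightarrow> 'a::real_normed_vector) \<Rightarrow> bool" where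
  "C1_nonneg x \<longleftrightarrow>
     (\<exists>x'. (\<forall>t\<ge>0. (x has_vector_derivative x' t) (at t within {0..})) \<and> continuous_on {0..} x')"

definition NAG_solution ::
  "('a::real_inner \<Rightarrow> real) \<Rightarrow> real \<Rightarrow> 'a \<Rightarrow> (real \<Rightarrow> 'a) \<Rightarrow> (real \<Rightarrow> 'a) \<Rightarrow> bool" where
  "NAG_solution f r x0 x z \<longleftrightarrow>
     C1_nonneg x \<and> C1_nonneg z \<and> x 0 = x0 \<and> z 0 = x0 \<and>
     (\<forall>t>0. (x has_vector_derivative (r / t) *\<^sub>R (z t - x t)) (at t) \<and>
            (z has_vector_derivative - (t / r) *\<^sub>R grad f (x t)) (at t))"

definition NAG_dual :: "real \<Rightarrow> (real \<Rightarrow> 'a::real_vector) \<Rightarrow> (real \<Rightarrow> 'a) \<Rightarrow> real \<Rightarrow> 'a" where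
  "NAG_dual r x z t = (r * (r + 2) / t\<^sup>2) *\<^sub>R (x t - z t)"

lemma NAG_dual_eq_velocity:
  assumes "NAG_solution f r x0 x z" and "t > 0"
  shows "NAG_dual r x z t = - ((r + 2) / t) *\<^sub>R vector_derivative x (at t)"
proof -
  have "vector_derivative x (at t) = (r / t) *\<^sub>R (z t - x t)"
    using assms unfolding NAG_solution_def by (blast intro: vector_derivative_at)
  then show ?thesis
    by (simp add: NAG_dual_def power2_eq_square scaleR_right_diff_distrib mult.commute)
qed

end

theory Submission
  imports Defs
begin

text \<open>
  Since \<open>(t powr r *\<^sub>R (x t - z t))' = (t powr (r + 1) / r) *\<^sub>R grad f (x t)\<close>, the point
  \<open>p t\<close> is the average of the gradients \<open>grad f (x s)\<close> over \<open>0 < s < t\<close> with weights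
  proportional to \<open>s powr (r + 1)\<close>. The conjugate is finite and continuous in \<open>s\<close> along
  these gradients, so Jensen's inequality gives (a); integrals are avoided by testing against
  each \<open>y\<close> and comparing derivatives.

  For (b), minimality of \<open>ps\<close> in the convex domain gives \<open>\<parallel>ps\<parallel>\<^sup>2 \<le> ps \<bullet> p t\<close>, hence the
  first inequality. For the second, let \<open>v\<close> be the velocity of \<open>x\<close>, so that
  \<open>p t = - ((r + 2) / t) *\<^sub>R v t\<close>. The energy
  \<open>\<parallel>v\<parallel>\<^sup>2 / 2 + f x - ps \<bullet> x - t\<^sup>2 \<parallel>ps\<parallel>\<^sup>2 / (2 (r + 2)\<^sup>2)\<close> has derivative at most
  \<open>- t (\<parallel>p\<parallel> - \<parallel>ps\<parallel>) ((r + 1) \<parallel>p\<parallel> - \<parallel>ps\<parallel>) / (r + 2)\<^sup>2 \<le> 0\<close>, and its initial value is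
  \<open>f x0 - ps \<bullet> x0\<close>; conclude with the Fenchel-Young inequality at \<open>x t\<close>.
\<close>

section \<open>Derivatives along curves and the tangent inequality\<close>

lemma GDERIV_chain_vector:
  assumes "GDERIV f (x t) :> D" and "(x has_vector_derivative v) (at t)"
  shows "((\<lambda>s. f (x s)) has_real_derivative D \<bullet> v) (at t)"
  using diff_chain_at[OF assms(2)[unfolded has_vector_derivative_def] assms(1)[unfolded gderiv_def]]
  by (simp add: has_field_derivative_def o_def inner_commute mult_commute_abs)

text \<open>Restricted to the line through \<open>x\<close> and \<open>y\<close>, this is the
  one-variable tangent inequality between the parameters 0 and 1.\<close>

lemma convex_GDERIV_above_tangent:
  fixes f :: "'a::real_inner \<Rightarrow> real"
  assumes "convex_on UNIV f" and "GDERIV f x :> D"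
  shows "f x + D \<bullet> (y - x) \<le> f y"
proof -
  define h where "h = (\<lambda>t::real. x + t *\<^sub>R (y - x))"
  have "convex_on UNIV (f \<circ> h)"
  proof (rule convex_onI)
    fix t a b :: real
    assume "0 < t" "t < 1"
    moreover have "h ((1 - t) *\<^sub>R a + t *\<^sub>R b) = (1 - t) *\<^sub>R h a + t *\<^sub>R h b"
      by (simp add: h_def algebra_simps)
    ultimately show "(f \<circ> h) ((1 - t) *\<^sub>R a + t *\<^sub>R b) \<le> (1 - t) * (f \<circ> h) a + t * (f \<circ> h) b"
      using convex_onD[OF assms(1), of t "h a" "h b"] by simp
  qed simp
  moreover have "(f \<circ> h has_real_derivative D \<bullet> (y - x)) (at 0)"
  proof -
    have "(h has_vector_derivative y - x) (at 0)"
      unfolding h_def by (auto intro!: derivative_eq_intros)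
    then show ?thesis
      using GDERIV_chain_vector[of f h 0 D] assms(2) by (simp add: h_def o_def)
  qed
  ultimately have "D \<bullet> (y - x) * (1 - 0) \<le> (f \<circ> h) 1 - (f \<circ> h) 0"
    by (intro convex_on_imp_above_tangent[of UNIV "f \<circ> h" 0 1]) auto
  then show ?thesis
    by (simp add: h_def)
qed

lemma has_real_derivative_inner:
  fixes x y :: "real \<Rightarrow> 'a::real_inner"
  assumes "(x has_vector_derivative x') (at t)" and "(y has_vector_derivative y') (at t)"
  shows "((\<lambda>s. x s \<bullet> y s) has_real_derivative x t \<bullet> y' + x' \<bullet> y t) (at t)"
  unfolding has_real_derivative_iff_has_vector_derivative
  by (rule bounded_bilinear.has_vector_derivative[OF bounded_bilinear_inner assms])

section \<open>The domain of the conjugate and its minimum-norm point\<close>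

lemma conj_domE:
  assumes "p \<in> conj_dom f"
  obtains c where "conjugate f p = ereal c" and "\<And>y. p \<bullet> y - f y \<le> c"
proof -
  have le: "ereal (p \<bullet> y - f y) \<le> conjugate f p" for y
    unfolding conjugate_def by (rule SUP_upper) simp
  show thesis
  proof (cases "conjugate f p")
    case (real c)
    then show thesis using that le by auto
  \<comment> \<open>Membership excludes the value \<infinity>; the term of the supremum at
    \<open>0\<close> excludes the value -\<infinity>.\<close>
  qed (use assms le[of 0] in \<open>auto simp: conj_dom_def\<close>)
qed

lemma conj_domI:
  assumes "\<And>y. p \<bullet> y - f y \<le> M"
  shows "p \<in> conj_dom f"
proof -
  have "conjugate f p \<le> ereal M"
    unfolding conjugate_def using assms by (intro SUP_least) simp
  then show ?thesis
    unfolding conj_dom_def by auto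
qed

lemma convex_conj_dom: "convex (conj_dom f)"
  unfolding convex_def
proof (intro ballI allI impI)
  fix p q and u v :: real
  assume "p \<in> conj_dom f" "q \<in> conj_dom f" and uv: "0 \<le> u" "0 \<le> v" "u + v = 1"
  then obtain M N where "\<And>y. p \<bullet> y - f y \<le> M" "\<And>y. q \<bullet> y - f y \<le> N"
    by (metis conj_domE)
  then have "u * (p \<bullet> y - f y) + v * (q \<bullet> y - f y) \<le> u * M + v * N" for y
    using uv by (intro add_mono mult_left_mono)
  moreover have "u * (p \<bullet> y - f y) + v * (q \<bullet> y - f y) = (u *\<^sub>R p + v *\<^sub>R q) \<bullet> y - (u + v) * f y" for y
    by (simp add: algebra_simps)
  ultimately show "u *\<^sub>R p + v *\<^sub>R q \<in> conj_dom f"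
    using uv by (intro conj_domI) auto
qed

text \<open>This is the variational inequality for the projection of the origin. As \<open>S\<close>
  may fail to be closed, it is applied to the segment from \<open>p\<close> to \<open>q\<close>,
  which is closed, lies in \<open>S\<close> by convexity, and still has \<open>p\<close> as a point
  closest to the origin.\<close>

lemma min_norm_point_inner:
  fixes S :: "'a::euclidean_space set"
  assumes "convex S" and "min_norm_point S p" and "q \<in> S"
  shows "(norm p)\<^sup>2 \<le> p \<bullet> q"
proof -
  have "closed_segment p q \<subseteq> S"
    using assms by (intro closed_segment_subset) (auto simp: min_norm_point_def)
  then have "inner (0 - p) (q - p) \<le> 0"
    using assms(2)
    by (intro any_closest_point_dot[of "closed_segment p q"]) (auto simp: min_norm_point_def)
  then show ?thesis
    by (simp add: inner_diff_right power2_norm_eq_inner)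
qed

section \<open>Behaviour of the solution at the singular time 0\<close>

lemma has_vector_derivative_right_quotient:
  fixes h :: "real \<Rightarrow> 'a::real_normed_vector"
  assumes "(h has_vector_derivative v) (at 0 within {0..})" and "h 0 = 0"
  shows "((\<lambda>t. (1 / t) *\<^sub>R h t) \<longlongrightarrow> v) (at_right 0)"
proof -
  have "(h has_vector_derivative v) (at 0 within {0<..})"
    using assms(1) by (rule has_vector_derivative_within_subset) auto
  then have "((\<lambda>y. (1 / \<bar>y\<bar>) *\<^sub>R (h y - y *\<^sub>R v)) \<longlongrightarrow> 0) (at_right 0)"
    using assms(2) by (simp add: has_vector_derivative_def has_derivative_within)
  then have "((\<lambda>y. (1 / \<bar>y\<bar>) *\<^sub>R (h y - y *\<^sub>R v) + v) \<longlongrightarrow> 0 + v) (at_right 0)"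
    by (intro tendsto_add tendsto_const)
  moreover have "\<forall>\<^sub>F y in at_right 0. (1 / \<bar>y\<bar>) *\<^sub>R (h y - y *\<^sub>R v) + v = (1 / y) *\<^sub>R h y"
    by (rule eventually_at_rightI[of 0 1]) (auto simp: algebra_simps)
  ultimately show ?thesis
    by (simp add: tendsto_cong)
qed

lemma continuous_on_C1_nonneg: "C1_nonneg x \<Longrightarrow> continuous_on {0..} x"
  unfolding C1_nonneg_def by (auto intro: continuous_on_vector_derivative)

text \<open>One-sided and two-sided derivatives agree at positive times, so \<open>x'\<close>
  extends \<open>v\<close> continuously to time 0, where the ODE says nothing.\<close>

lemma C1_nonneg_derivativeE:
  assumes "C1_nonneg x" and "\<And>t. t > 0 \<Longrightarrow> (x has_vector_derivative v t) (at t)"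
  obtains x' where "(x has_vector_derivative x' 0) (at 0 within {0..})"
    and "continuous_on {0..} x'" and "\<And>t. t > 0 \<Longrightarrow> x' t = v t"
proof -
  obtain x' where x': "\<And>t. t \<ge> 0 \<Longrightarrow> (x has_vector_derivative x' t) (at t within {0..})"
    and "continuous_on {0..} x'"
    using assms(1) unfolding C1_nonneg_def by blast
  moreover have "x' t = v t" if "t > 0" for t
  proof -
    have "at t within {0..} = at t"
      using that by (intro at_within_interior) auto
    then show ?thesis
      using x'[of t] assms(2)[of t] that by (simp add: vector_derivative_unique_at)
  qed
  ultimately show thesis
    using that by auto
qed

text \<open>The initial velocity must vanish for the energy to start at
  \<open>f x0 - ps \<bullet> x0\<close>. The ODE forces \<open>z'\<close> to tend to 0, so
  \<open>(r / t) *\<^sub>R (z t - x t)\<close> tends to \<open>- r *\<^sub>R v 0\<close>. By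
  continuity the same limit is \<open>v 0\<close>, whence
  \<open>(1 + r) *\<^sub>R v 0 = 0\<close>.\<close>

lemma NAG_velocityE:
  fixes f :: "'a::euclidean_space \<Rightarrow> real"
  assumes "NAG_solution f r x0 x z" and "r > 0" and "continuous_on UNIV (grad f)"
  obtains v where "continuous_on {0..} v" and "v 0 = 0"
    and "\<And>t. t > 0 \<Longrightarrow> v t = (r / t) *\<^sub>R (z t - x t)"
proof -
  obtain v where v: "(x has_vector_derivative v 0) (at 0 within {0..})"
      "continuous_on {0..} v" "\<And>t. t > 0 \<Longrightarrow> v t = (r / t) *\<^sub>R (z t - x t)"
    using assms(1) C1_nonneg_derivativeE[of x "\<lambda>t. (r / t) *\<^sub>R (z t - x t)"]
    unfolding NAG_solution_def by metis
  obtain w where w: "(z has_vector_derivative w 0) (at 0 within {0..})"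
      "continuous_on {0..} w" "\<And>t. t > 0 \<Longrightarrow> w t = - (t / r) *\<^sub>R grad f (x t)"
    using assms(1) C1_nonneg_derivativeE[of z "\<lambda>t. - (t / r) *\<^sub>R grad f (x t)"]
    unfolding NAG_solution_def by metis
  have right_limit: "(u \<longlongrightarrow> u 0) (at_right 0)" if "continuous_on {0..} u" for u :: "real \<Rightarrow> 'a"
    using that by (auto simp: continuous_on_def intro: tendsto_within_subset)
  have pos: "\<forall>\<^sub>F t::real in at_right 0. t > 0"
    by (simp add: eventually_at_right_less)
  have "continuous_on {0..} (\<lambda>t. - (t / r) *\<^sub>R grad f (x t))"
    using assms unfolding NAG_solution_def
    by (intro continuous_intros continuous_on_compose2[OF assms(3) continuous_on_C1_nonneg]) auto
  then have "((\<lambda>t. - (t / r) *\<^sub>R grad f (x t)) \<longlongrightarrow> 0) (at_right 0)"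
    using right_limit by fastforce
  then have "(w \<longlongrightarrow> 0) (at_right 0)"
    by (rule tendsto_cong[THEN iffD2, rotated]) (use pos w(3) in \<open>auto elim: eventually_mono\<close>)
  then have w0: "w 0 = 0"
    using right_limit[OF w(2)] tendsto_unique[of "at_right (0::real)" w] by simp
  have "((\<lambda>t. z t - x t) has_vector_derivative - v 0) (at 0 within {0..})"
    using has_vector_derivative_diff[OF w(1) v(1)] w0 by simp
  then have "((\<lambda>t. (1 / t) *\<^sub>R (z t - x t)) \<longlongrightarrow> - v 0) (at_right 0)"
    using assms(1) by (intro has_vector_derivative_right_quotient) (auto simp: NAG_solution_def)
  then have "((\<lambda>t. r *\<^sub>R (1 / t) *\<^sub>R (z t - x t)) \<longlongrightarrow> r *\<^sub>R (- v 0)) (at_right 0)"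
    by (intro tendsto_scaleR tendsto_const)
  then have "(v \<longlongrightarrow> r *\<^sub>R (- v 0)) (at_right 0)"
    by (rule tendsto_cong[THEN iffD2, rotated]) (use pos v(3) in \<open>auto elim: eventually_mono\<close>)
  then have "v 0 = r *\<^sub>R (- v 0)"
    using right_limit[OF v(2)] tendsto_unique[of "at_right (0::real)" v] by simp
  then have "(1 + r) *\<^sub>R v 0 = 0"
    by (simp add: scaleR_left_distrib eq_neg_iff_add_eq_0)
  then have "v 0 = 0"
    using assms(2) by simp
  with v show thesis
    using that by blast
qed

section \<open>Estimates for the dual trajectory\<close>

lemma NAG_dual_in_conj_dom:
  fixes f :: "'a::euclidean_space \<Rightarrow> real"
  assumes sol: "NAG_solution f r x0 x z" and "r > 0"
    and cvx: "convex_on UNIV f" and GD: "\<And>y. GDERIV f y :> grad f y"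
    and cont: "continuous_on UNIV f" "continuous_on UNIV (grad f)" and "t > 0"
  shows "NAG_dual r x z t \<in> conj_dom f"
proof -
  have cx: "continuous_on {0..t} x" and cz: "continuous_on {0..t} z"
    using sol unfolding NAG_solution_def
    by (auto intro!: continuous_on_subset[OF continuous_on_C1_nonneg])
  \<comment> \<open>By equality in Fenchel-Young this function is the conjugate at
    \<open>grad f (x s)\<close>; compactness bounds it by one \<open>M\<close> on the whole
    interval.\<close>
  have "continuous_on {0..t} (\<lambda>s. grad f (x s) \<bullet> x s - f (x s))"
    by (intro continuous_intros continuous_on_compose2[OF cont(1) cx]
        continuous_on_compose2[OF cont(2) cx] cx) auto
  then have "bdd_above ((\<lambda>s. grad f (x s) \<bullet> x s - f (x s)) ` {0..t})"
    by (intro bounded_imp_bdd_above compact_imp_bounded compact_continuous_image) auto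
  then obtain M where M: "\<And>s. s \<in> {0..t} \<Longrightarrow> grad f (x s) \<bullet> x s - f (x s) \<le> M"
    unfolding bdd_above_def by blast
  have "NAG_dual r x z t \<bullet> y - f y \<le> M" for y
  proof -
    \<comment> \<open>For \<open>s > 0\<close> this is \<open>s powr (r + 2)\<close> times
      \<open>NAG_dual r x z s \<bullet> y - f y - M\<close>, written without division so that it is
      continuous at 0. The weight makes the terms in \<open>x s - z s\<close> cancel in the
      derivative.\<close>
    define \<phi> where "\<phi> = (\<lambda>s. r * (r + 2) * s powr r * ((x s - z s) \<bullet> y) - s powr (r + 2) * (f y + M))"
    have "\<phi> t \<le> \<phi> 0"
    proof (rule DERIV_nonpos_imp_decreasing_open[where f = \<phi> and a = 0 and b = t])
      fix s assume s: "0 < s" "s < t"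
      define q where "q = x s - z s"
      let ?g = "grad f (x s)"
      have "((\<lambda>s. x s - z s) has_vector_derivative (r / s) *\<^sub>R (z s - x s) - (- (s / r) *\<^sub>R ?g)) (at s)"
        using sol s(1) unfolding NAG_solution_def by (intro has_vector_derivative_diff) auto
      then have "((\<lambda>s. x s - z s) has_vector_derivative (s / r) *\<^sub>R ?g - (r / s) *\<^sub>R q) (at s)"
        by (simp add: q_def algebra_simps)
      from has_real_derivative_inner[OF this has_vector_derivative_const]
      have "((\<lambda>s. (x s - z s) \<bullet> y) has_real_derivative (s / r) * (?g \<bullet> y) - (r / s) * (q \<bullet> y)) (at s)"
        by (simp add: inner_diff_left)
      then have "(\<phi> has_real_derivative r * (r + 2) * (r * s powr (r - 1)) * (q \<bullet> y)
          + r * (r + 2) * s powr r * ((s / r) * (?g \<bullet> y) - (r / s) * (q \<bullet> y))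
          - (r + 2) * s powr (r + 1) * (f y + M)) (at s)"
        unfolding \<phi>_def q_def using s(1) by (auto intro!: derivative_eq_intros simp: add.commute)
      also have "r * (r + 2) * (r * s powr (r - 1)) * (q \<bullet> y)
          + r * (r + 2) * s powr r * ((s / r) * (?g \<bullet> y) - (r / s) * (q \<bullet> y))
          - (r + 2) * s powr (r + 1) * (f y + M) = (r + 2) * s powr (r + 1) * (?g \<bullet> y - f y - M)"
        using s(1) \<open>r > 0\<close> by (simp add: powr_diff powr_add field_simps)
      finally have "(\<phi> has_real_derivative (r + 2) * s powr (r + 1) * (?g \<bullet> y - f y - M)) (at s)" .
      \<comment> \<open>The tangent at \<open>x s\<close> gives
        \<open>?g \<bullet> y - f y \<le> ?g \<bullet> x s - f (x s)\<close>, which is at most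
        \<open>M\<close>.\<close>
      moreover have "?g \<bullet> y - f y - M \<le> 0"
        using convex_GDERIV_above_tangent[OF cvx GD, of "x s" y] M[of s] s
        by (simp add: inner_diff_right)
      then have "(r + 2) * s powr (r + 1) * (?g \<bullet> y - f y - M) \<le> 0"
        using \<open>r > 0\<close> by (intro mult_nonneg_nonpos) auto
      ultimately show "\<exists>D. (\<phi> has_real_derivative D) (at s) \<and> D \<le> 0"
        by blast
    next
      show "continuous_on {0..t} \<phi>"
        unfolding \<phi>_def using \<open>r > 0\<close>
        by (intro continuous_intros continuous_on_powr' cx cz) auto
    qed (use \<open>t > 0\<close> in simp)
    also have "\<phi> 0 = 0"
      by (simp add: \<phi>_def)
    finally have "t powr r * (r * (r + 2) * ((x t - z t) \<bullet> y)) \<le> t powr r * (t\<^sup>2 * (f y + M))"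
      using \<open>t > 0\<close> by (simp add: \<phi>_def powr_add algebra_simps)
    then have "r * (r + 2) * ((x t - z t) \<bullet> y) \<le> t\<^sup>2 * (f y + M)"
      using \<open>t > 0\<close> by simp
    then have "r * (r + 2) * ((x t - z t) \<bullet> y) / t\<^sup>2 \<le> f y + M"
      using \<open>t > 0\<close> by (simp add: pos_divide_le_eq mult.commute)
    then show ?thesis
      by (simp add: NAG_dual_def)
  qed
  then show ?thesis
    by (rule conj_domI)
qed

text \<open>The real bound \<open>c\<close> will be the conjugate at \<open>ps\<close>, which keeps
  the energy argument in the reals. Minimality of \<open>ps\<close> enters only as a comparison of
  norms along the trajectory.\<close>

lemma NAG_dual_norm_bound:
  fixes f :: "'a::euclidean_space \<Rightarrow> real"
  assumes sol: "NAG_solution f r x0 x z" and "r > 0"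
    and GD: "\<And>y. GDERIV f y :> grad f y"
    and cont: "continuous_on UNIV f" "continuous_on UNIV (grad f)" and "t > 0"
    and c: "\<And>y. ps \<bullet> y - f y \<le> c"
    and min: "\<And>s. s > 0 \<Longrightarrow> norm ps \<le> norm (NAG_dual r x z s)"
  shows "t\<^sup>2 * ((norm (NAG_dual r x z t))\<^sup>2 - (norm ps)\<^sup>2) \<le> 2 * (r + 2)\<^sup>2 * (f x0 + c - ps \<bullet> x0)"
proof -
  let ?p = "NAG_dual r x z"
  obtain v where cv: "continuous_on {0..} v" and v0: "v 0 = 0"
    and v: "\<And>s. s > 0 \<Longrightarrow> v s = (r / s) *\<^sub>R (z s - x s)"
    using NAG_velocityE[OF sol \<open>r > 0\<close> cont(2)] by blast
  have cx: "continuous_on {0..t} x"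
    using sol unfolding NAG_solution_def
    by (auto intro!: continuous_on_subset[OF continuous_on_C1_nonneg])
  have vp: "v s = - (s / (r + 2)) *\<^sub>R ?p s" if "s > 0" for s
    using that \<open>r > 0\<close> by (simp add: v NAG_dual_def power2_eq_square scaleR_right_diff_distrib)
  \<comment> \<open>By \<open>vp\<close> the kinetic term is
    \<open>s\<^sup>2 / (2 * (r + 2)\<^sup>2) * (norm (?p s))\<^sup>2\<close>. The last term has the
    same coefficient, so that the difference of squared norms appears.\<close>
  define E where "E = (\<lambda>s. v s \<bullet> v s / 2 + f (x s) - ps \<bullet> x s - s\<^sup>2 / (2 * (r + 2)\<^sup>2) * (norm ps)\<^sup>2)"
  have "E t \<le> E 0"
  proof (rule DERIV_nonpos_imp_decreasing_open[where f = E and a = 0 and b = t])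
    fix s assume s: "0 < s" "s < t"
    let ?g = "grad f (x s)"
    have x': "(x has_vector_derivative v s) (at s)"
      and z': "(z has_vector_derivative - (s / r) *\<^sub>R ?g) (at s)"
      using sol s(1) v by (auto simp: NAG_solution_def)
    \<comment> \<open>This leads to the second-order form
      \<open>x'' = - ((r + 1) / s) *\<^sub>R x' - grad f x\<close>: the damping gets
      \<open>r\<close> from \<open>- v s\<close> and 1 from differentiating \<open>r / s\<close>.
      The formula for \<open>v\<close> holds only at positive times, hence the transfer on
      \<open>{0<..}\<close>.\<close>
    have "((\<lambda>s. (r / s) *\<^sub>R (z s - x s)) has_vector_derivative
        (r / s) *\<^sub>R (- (s / r) *\<^sub>R ?g - v s) + (- r / s\<^sup>2) *\<^sub>R (z s - x s)) (at s)"
      using s(1) by (intro has_vector_derivative_scaleR has_vector_derivative_diff x' z')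
        (auto intro!: derivative_eq_intros simp: power2_eq_square)
    moreover have "(r / s) *\<^sub>R (- (s / r) *\<^sub>R ?g - v s) + (- r / s\<^sup>2) *\<^sub>R (z s - x s)
        = - ((r + 1) / s) *\<^sub>R v s - ?g"
    proof -
      have "(- r / s\<^sup>2) *\<^sub>R (z s - x s) = - (1 / s) *\<^sub>R v s"
        using s(1) by (simp add: v power2_eq_square)
      then show ?thesis
        using s(1) \<open>r > 0\<close>
        by (simp only:) (simp add: add_divide_distrib scaleR_left_distrib scaleR_left_diff_distrib
          scaleR_right_diff_distrib)
    qed
    ultimately have v': "(v has_vector_derivative - ((r + 1) / s) *\<^sub>R v s - ?g) (at s)"
      using s(1) v
      by (auto intro: has_vector_derivative_transform_within_open[of _ _ _ "{0<..}"])
    define D where "D = v s \<bullet> (- ((r + 1) / s) *\<^sub>R v s - ?g) + ?g \<bullet> v s - ps \<bullet> v s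
        - s / (r + 2)\<^sup>2 * (norm ps)\<^sup>2"
    have d1: "((\<lambda>s. v s \<bullet> v s / 2) has_real_derivative v s \<bullet> (- ((r + 1) / s) *\<^sub>R v s - ?g)) (at s)"
      using DERIV_cdivide[OF has_real_derivative_inner[OF v' v'], of 2] by (simp add: inner_commute)
    have d2: "((\<lambda>s. ps \<bullet> x s) has_real_derivative ps \<bullet> v s) (at s)"
      using has_real_derivative_inner[OF has_vector_derivative_const x'] by simp
    have d3: "((\<lambda>s. s\<^sup>2 / (2 * (r + 2)\<^sup>2) * (norm ps)\<^sup>2) has_real_derivative
        s / (r + 2)\<^sup>2 * (norm ps)\<^sup>2) (at s)"
      using \<open>r > 0\<close> by (auto intro!: derivative_eq_intros simp: divide_simps power2_eq_square)
    have "(E has_real_derivative D) (at s)"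
      unfolding E_def D_def
      by (intro DERIV_diff DERIV_add d1 d2 d3 GDERIV_chain_vector GD x')
    moreover have "D \<le> 0"
    proof -
      \<comment> \<open>The gradient terms of the kinetic and potential energy cancel.\<close>
      have "D = - ((r + 1) / s) * (v s \<bullet> v s) - ps \<bullet> v s - s / (r + 2)\<^sup>2 * (norm ps)\<^sup>2"
        by (simp add: D_def inner_diff_right inner_commute)
      also have "\<dots> = s / (r + 2)\<^sup>2 * ((r + 2) * (ps \<bullet> ?p s) - (r + 1) * (norm (?p s))\<^sup>2 - (norm ps)\<^sup>2)"
        using s(1) \<open>r > 0\<close> unfolding vp[OF s(1)]
        by (simp add: power2_norm_eq_inner divide_simps) (simp add: algebra_simps power2_eq_square)
      also have "\<dots> \<le> 0"
      proof (rule mult_nonneg_nonpos)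
        have "(r + 2) * (ps \<bullet> ?p s) \<le> (r + 2) * (norm ps * norm (?p s))"
          using \<open>r > 0\<close> by (intro mult_left_mono norm_cauchy_schwarz) auto
        \<comment> \<open>The product is the factorization of the quadratic form
          \<open>(r + 1) * b\<^sup>2 - (r + 2) * a * b + a\<^sup>2\<close> with
          \<open>a = norm ps\<close> and \<open>b = norm (?p s)\<close>; here
          \<open>a \<le> b\<close>.\<close>
        moreover have "0 \<le> (norm (?p s) - norm ps) * ((r + 1) * norm (?p s) - norm ps)"
        proof (rule mult_nonneg_nonneg)
          have "0 \<le> r * norm (?p s)"
            using \<open>r > 0\<close> by simp
          then show "0 \<le> (r + 1) * norm (?p s) - norm ps"
            using min[OF s(1)] by (simp add: algebra_simps)
        qed (use min[OF s(1)] in simp)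
        ultimately show "(r + 2) * (ps \<bullet> ?p s) - (r + 1) * (norm (?p s))\<^sup>2 - (norm ps)\<^sup>2 \<le> 0"
          by (simp add: algebra_simps power2_eq_square)
      qed (use s(1) in simp)
      finally show ?thesis .
    qed
    ultimately show "\<exists>D. (E has_real_derivative D) (at s) \<and> D \<le> 0"
      by blast
  next
    have "continuous_on {0..t} v"
      using cv by (rule continuous_on_subset) auto
    then show "continuous_on {0..t} E"
      unfolding E_def using \<open>r > 0\<close> by (intro continuous_intros continuous_on_compose2[OF cont(1) cx] cx) auto
  qed (use \<open>t > 0\<close> in simp)
  also have "E 0 = f x0 - ps \<bullet> x0"
    using sol by (simp add: E_def v0 NAG_solution_def)
  finally have "v t \<bullet> v t / 2 - t\<^sup>2 / (2 * (r + 2)\<^sup>2) * (norm ps)\<^sup>2 \<le> f x0 + c - ps \<bullet> x0"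
    using c[of "x t"] by (simp add: E_def)
  moreover have "v t \<bullet> v t = t\<^sup>2 / (r + 2)\<^sup>2 * (norm (?p t))\<^sup>2"
    unfolding vp[OF \<open>t > 0\<close>] power2_norm_eq_inner by (simp add: power2_eq_square)
  ultimately have "(t\<^sup>2 * ((norm (?p t))\<^sup>2 - (norm ps)\<^sup>2)) / (2 * (r + 2)\<^sup>2) \<le> f x0 + c - ps \<bullet> x0"
    by (simp add: right_diff_distrib diff_divide_distrib)
  then show ?thesis
    using \<open>r > 0\<close> by (simp add: pos_divide_le_eq mult.commute)
qed

theorem theorem4p3:
  fixes f :: "real ^ 'n \<Rightarrow> real" and r :: real and x0 :: "real ^ 'n"
    and x z :: "real \<Rightarrow> real ^ 'n"
  assumes "f \<in> smooth_convex_fin" and "r > 0" and "NAG_solution f r x0 x z"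
  shows "(\<forall>t>0. NAG_dual r x z t \<in> conj_dom f) \<and>
    (\<forall>ps. min_norm_point (conj_dom f) ps \<longrightarrow>
      (\<forall>t>0. (norm (NAG_dual r x z t - ps))\<^sup>2 \<le> (norm (NAG_dual r x z t))\<^sup>2 - (norm ps)\<^sup>2 \<and>
        ereal ((norm (NAG_dual r x z t))\<^sup>2 - (norm ps)\<^sup>2)
          \<le> ereal (2 * (r + 2)\<^sup>2) * dual_div f x0 ps / ereal (t\<^sup>2)))"
proof -
  obtain L where cvx: "convex_on UNIV f" and diff: "\<And>y. f differentiable (at y)"
    and "L-lipschitz_on UNIV (grad f)"
    using assms(1) by (auto simp: smooth_convex_fin_def smooth_convex_def)
  then have cont_grad: "continuous_on UNIV (grad f)"
    by (intro lipschitz_on_continuous_on)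
  have GD: "GDERIV f y :> grad f y" for y
    using diff by (rule GDERIV_grad)
  have cont: "continuous_on UNIV f"
    using diff by (simp add: continuous_on_eq_continuous_at differentiable_imp_continuous_within)
  let ?p = "NAG_dual r x z"
  have dom: "?p t \<in> conj_dom f" if "t > 0" for t
    using NAG_dual_in_conj_dom[OF assms(3,2) cvx GD cont cont_grad that] .
  moreover have "(norm (?p t - ps))\<^sup>2 \<le> (norm (?p t))\<^sup>2 - (norm ps)\<^sup>2 \<and>
      ereal ((norm (?p t))\<^sup>2 - (norm ps)\<^sup>2) \<le> ereal (2 * (r + 2)\<^sup>2) * dual_div f x0 ps / ereal (t\<^sup>2)"
    if ps: "min_norm_point (conj_dom f) ps" and "t > 0" for ps t
  proof
    \<comment> \<open>On expanding the square, the variational inequality bounds the cross term by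
      \<open>- 2 * (norm ps)\<^sup>2\<close>.\<close>
    show "(norm (?p t - ps))\<^sup>2 \<le> (norm (?p t))\<^sup>2 - (norm ps)\<^sup>2"
      using min_norm_point_inner[OF convex_conj_dom ps dom[OF \<open>t > 0\<close>]]
      by (simp add: power2_norm_eq_inner inner_diff_left inner_diff_right inner_commute)
    obtain c where c: "conjugate f ps = ereal c" "\<And>y. ps \<bullet> y - f y \<le> c"
      using ps conj_domE unfolding min_norm_point_def by metis
    have "norm ps \<le> norm (?p s)" if "s > 0" for s
      using ps dom[OF that] by (auto simp: min_norm_point_def)
    then have "t\<^sup>2 * ((norm (?p t))\<^sup>2 - (norm ps)\<^sup>2) \<le> 2 * (r + 2)\<^sup>2 * (f x0 + c - ps \<bullet> x0)"
      using NAG_dual_norm_bound[OF assms(3,2) GD cont cont_grad \<open>t > 0\<close> c(2)] by blast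
    then show "ereal ((norm (?p t))\<^sup>2 - (norm ps)\<^sup>2)
        \<le> ereal (2 * (r + 2)\<^sup>2) * dual_div f x0 ps / ereal (t\<^sup>2)"
      using \<open>t > 0\<close> by (simp add: dual_div_def c(1) pos_le_divide_eq mult.commute)
  qed
  ultimately show ?thesis
    by blast
qed

end
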